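(* Let $(\tau_k)_{k\ge0}$ be the step-size sequence generated by Algorithm 1 (described in the context), and set $\sigma_k:=\beta\tau_k$. If $\tau_0\le\frac{\mu\sqrt{\lambda_{\min}(S)}}{\sqrt\beta\,\|A\|}$, then $\tau_k=\tau_0$ for all $k\ge1$. Consequently, $\sigma_k=\beta\tau_0$ for all $k\ge1$, and $$\tau_k\sigma_k\|A\|^2=\beta\tau_0^2\|A\|^2\le\mu^2\lambda_{\min}(S)<\psi\lambda_{\min}(S)\qquad\text{for all }k\ge1,$$ which is precisely the step-size condition $\tau\sigma\|A\|^2<\psi\lambda_{\min}(S)$ required in the fixed step-size golden ratio proximal ADMM with $\tau=\tau_0$ and $\sigma=\beta\tau_0$.
   Context: **Problem.** $g:\mathbb{R}^q\to\mathbb{R}\cup\{+\infty\}$ and $f:\mathbb{R}^p\to\mathbb{R}\cup\{+\infty\}$ are proper, closed, convex functions, $A\in\mathbb{R}^{m\times q}$, $B\in\mathbb{R}^{m\times p}$, $b\in\mathbb{R}^m$. The problem is $\min_{x,w} g(x)+f(w)$ subject to $Ax+Bw=b$. Set $\mathbb{L}(x,w,y):=g(x)+f(w)+\langle y,Ax+Bw-b\rangle$ and, for $\sigma>0$, $\mathbb{L}_\sigma(x,w,y):=\mathbb{L}(x,w,y)+\frac{\sigma}{2}\|Ax+Bw-b\|^2$. **Standing assumption.** The solution set of the problem is nonempty, and there exist $\tilde x\in\operatorname{ri}(\operatorname{dom} g)$ and $\tilde w\in\operatorname{ri}(\operatorname{dom} f)$ with $A\tilde x+B\tilde w=b$ ($\operatorname{ri}$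 = relative interior). **Notation.** $\|\cdot\|$ is the Euclidean norm on vectors and the operator norm on matrices. For a symmetric positive semidefinite $M$, $\|y\|_M:=\sqrt{y^\top My}$. $\lambda_{\min}(M)$ is the smallest eigenvalue of $M$. $\varphi:=\frac{1+\sqrt5}{2}$. If $A=0$, the quotient with $\|A\|$ in its denominator is read as $+\infty$. **Algorithm 1.** Let $S\in\mathbb{R}^{q\times q}$ and $T\in\mathbb{R}^{p\times p}$ be symmetric positive definite, $x_0\in\mathbb{R}^q$, $w_0\in\mathbb{R}^p$, $y_0\in\mathbb{R}^m$, $u_0=x_0$, $\tau_0>0$, $\beta>0$, $\psi\in(1,\varphi]$, $0<\mu<\frac{\psi}{2}$. For $k=1,2,\dots$: $$u_k=\tfrac{\psi-1}{\psi}x_{k-1}+\tfrac1\psi u_{k-1},\qquad x_k=\arg\min_x\Big\{\mathbb{L}(x,w_{k-1},y_{k-1})+\tfrac{1}{2\tau_{k-1}}\|x-u_k\|_S^2\Big\},$$ $$\tau_k=\min\Big\{\tau_{k-1},\frac{\mu\sqrt{\lambda_{\min}(S)}}{\sqrt\beta\,L_k}\Big\},\qquad L_k:=\frac{\|Ax_k-Ax_{k-1}\|}{\|x_k-x_{k-1}\|},$$ with the convention that $\tau_k=\tau_{k-1}$ whenever $Ax_k=Ax_{k-1}$ (in particular whenever $x_k=x_{k-1}$), $$w_k=\arg\min_w\Big\{\mathbb{L}_{\beta\tau_k}(x_k,w,y_{k-1})+\tfrac12\|w-w_{k-1}\|_T^2\Big\},\qquad y_k=y_{k-1}+\beta\tau_k(Ax_k+Bw_k-b).$$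 **Fixed step-size golden ratio proximal ADMM.** The same iteration with $\tau_{k-1}$ replaced by a constant $\tau>0$ in the $x$-update and $\beta\tau_k$ replaced by a constant $\sigma>0$ in the $w$- and $y$-updates; its step-size condition is $\tau\sigma\|A\|^2<\psi\lambda_{\min}(S)$. *)

theory Defs
  imports "HOL-Analysis.Analysis"
begin

definition dom_fun :: "('a \<Rightarrow> ereal) \<Rightarrow> 'a set" where
  "dom_fun h = {x. h x < \<infinity>}"

definition epi_fun :: "('a \<Rightarrow> ereal) \<Rightarrow> ('a \<times> real) set" where
  "epi_fun h = {(x, r). h x \<le> ereal r}"

definition proper_fun :: "('a \<Rightarrow> ereal) \<Rightarrow> bool" where
  "proper_fun h \<longleftrightarrow> dom_fun h \<noteq> {} \<and> (\<forall>x. h x \<noteq> -\<infinity>)"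

definition closed_fun :: "('a::topological_space \<Rightarrow> ereal) \<Rightarrow> bool" where
  "closed_fun h \<longleftrightarrow> closed (epi_fun h)"

definition convex_fun :: "('a::real_vector \<Rightarrow> ereal) \<Rightarrow> bool" where
  "convex_fun h \<longleftrightarrow> convex (epi_fun h)"

definition sym_pos_def :: "real^'n^'n \<Rightarrow> bool" where
  "sym_pos_def M \<longleftrightarrow> transpose M = M \<and> (\<forall>v. v \<noteq> 0 \<longrightarrow> v \<bullet> (M *v v) > 0)"

text \<open>The set of real eigenvalues is finite, and it is nonempty whenever \<open>M\<close> is symmetric,
  so \<^term>\<open>Min\<close> is meaningful in the symmetric case.\<close>

definition lambda_min :: "real^'n^'n \<Rightarrow> real" where
  "lambda_min M = Min {c. \<exists>v. v \<noteq> 0 \<and> M *v v = c *\<^sub>R v}"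

definition weighted_norm :: "real^'n^'n \<Rightarrow> real^'n \<Rightarrow> real" where
  "weighted_norm M v = sqrt (v \<bullet> (M *v v))"

definition op_norm :: "real^'n^'m \<Rightarrow> real" where
  "op_norm A = onorm (\<lambda>v. A *v v)"

definition solutions ::
  "(real^'q \<Rightarrow> ereal) \<Rightarrow> (real^'p \<Rightarrow> ereal) \<Rightarrow> real^'q^'m \<Rightarrow> real^'p^'m \<Rightarrow> real^'m
    \<Rightarrow> ((real^'q) \<times> (real^'p)) set" where
  "solutions g f A B b =
    {z. is_arg_min (\<lambda>(x, w). g x + f w) (\<lambda>(x, w). A *v x + B *v w = b) z}"

definition lagrangian ::
  "(real^'q \<Rightarrow> ereal) \<Rightarrow> (real^'p \<Rightarrow> ereal) \<Rightarrow> real^'q^'m \<Rightarrow> real^'p^'m \<Rightarrow> real^'m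
    \<Rightarrow> real^'q \<Rightarrow> real^'p \<Rightarrow> real^'m \<Rightarrow> ereal" where
  "lagrangian g f A B b x w y = g x + f w + ereal (y \<bullet> (A *v x + B *v w - b))"

definition aug_lagrangian ::
  "(real^'q \<Rightarrow> ereal) \<Rightarrow> (real^'p \<Rightarrow> ereal) \<Rightarrow> real^'q^'m \<Rightarrow> real^'p^'m \<Rightarrow> real^'m \<Rightarrow> real
    \<Rightarrow> real^'q \<Rightarrow> real^'p \<Rightarrow> real^'m \<Rightarrow> ereal" where
  "aug_lagrangian g f A B b s x w y =
    lagrangian g f A B b x w y + ereal (s / 2 * (norm (A *v x + B *v w - b))\<^sup>2)"

definition golden_ratio :: real where
  "golden_ratio = (1 + sqrt 5) / 2"

definition next_step :: "real^'q^'m \<Rightarrow> real^'q^'q \<Rightarrow> real \<Rightarrow> real \<Rightarrow> real \<Rightarrow> real^'q \<Rightarrow> real^'q \<Rightarrow> real"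
  where
  "next_step A S \<beta> \<mu> t x_old x_new =
    (if A *v x_new = A *v x_old then t
     else min t (\<mu> * sqrt (lambda_min S) /
            (sqrt \<beta> * (norm (A *v x_new - A *v x_old) / norm (x_new - x_old)))))"

text \<open>If \<open>f (w 0) = \<infinity>\<close> (which is allowed, since \<open>w 0\<close> is arbitrary), the objective of the first
  \<open>x\<close>-update is identically infinite, and every point is a minimiser of it. In particular this
  covers the reading in which the summand \<open>f (w 0)\<close>, constant in \<open>x\<close>, is dropped.\<close>

definition adaptive_grp_admm ::
  "(real^'q \<Rightarrow> ereal) \<Rightarrow> (real^'p \<Rightarrow> ereal) \<Rightarrow> real^'q^'m \<Rightarrow> real^'p^'m \<Rightarrow> real^'m
    \<Rightarrow> real^'q^'q \<Rightarrow> real^'p^'p \<Rightarrow> real \<Rightarrow> real \<Rightarrow> real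
    \<Rightarrow> (nat \<Rightarrow> real^'q) \<Rightarrow> (nat \<Rightarrow> real^'q) \<Rightarrow> (nat \<Rightarrow> real^'p) \<Rightarrow> (nat \<Rightarrow> real^'m)
    \<Rightarrow> (nat \<Rightarrow> real) \<Rightarrow> bool" where
  "adaptive_grp_admm g f A B b S T \<beta> \<psi> \<mu> u x w y \<tau> \<longleftrightarrow>
    u 0 = x 0 \<and>
    (\<forall>k.
      u (Suc k) = ((\<psi> - 1) / \<psi>) *\<^sub>R x k + (1 / \<psi>) *\<^sub>R u k \<and>
      is_arg_min
        (\<lambda>x'. lagrangian g f A B b x' (w k) (y k)
               + ereal (1 / (2 * \<tau> k) * (weighted_norm S (x' - u (Suc k)))\<^sup>2))
        (\<lambda>_. True) (x (Suc k)) \<and>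
      \<tau> (Suc k) = next_step A S \<beta> \<mu> (\<tau> k) (x k) (x (Suc k)) \<and>
      is_arg_min
        (\<lambda>w'. aug_lagrangian g f A B b (\<beta> * \<tau> (Suc k)) (x (Suc k)) w' (y k)
               + ereal (1 / 2 * (weighted_norm T (w' - w k))\<^sup>2))
        (\<lambda>_. True) (w (Suc k)) \<and>
      y (Suc k) = y k + (\<beta> * \<tau> (Suc k)) *\<^sub>R (A *v x (Suc k) + B *v w (Suc k) - b))"

definition initial_step_bound :: "real^'q^'m \<Rightarrow> real^'q^'q \<Rightarrow> real \<Rightarrow> real \<Rightarrow> ereal" where
  "initial_step_bound A S \<beta> \<mu> =
    (if A = 0 then \<infinity> else ereal (\<mu> * sqrt (lambda_min S) / (sqrt \<beta> * op_norm A)))"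

definition fixed_step_condition :: "real^'q^'m \<Rightarrow> real^'q^'q \<Rightarrow> real \<Rightarrow> real \<Rightarrow> real \<Rightarrow> bool" where
  "fixed_step_condition A S \<psi> t s \<longleftrightarrow> t * s * (op_norm A)\<^sup>2 < \<psi> * lambda_min S"

end

(* A difference quotient of A never exceeds the operator norm, so a first step size below the
   bound with the operator norm in place of L_k is never cut down.  The strict inequality at the
   end needs lambda_min S > 0, that is, that the Min defining it is taken over a finite nonempty
   set: by orthogonality of eigenvectors and by minimising the Rayleigh quotient. *)
theory Submission
  imports Defs
begin

lemma symmetric_matrix_inner:
  fixes M :: "real^'n^'n"
  assumes "transpose M = M"
  shows "v \<bullet> (M *v w) = (M *v v) \<bullet> w"
  using assms by (metis dot_lmul_matrix transpose_matrix_vector)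

text \<open>A minimiser \<open>v\<close> of the quadratic form on the unit sphere works, with the
  minimum \<open>c\<close> as eigenvalue: the form \<open>Q\<close> of M - c I is nonnegative
  everywhere and zero at \<open>v\<close>, so its gradient there, which is twice the residual
  \<open>z\<close>, must vanish.\<close>

lemma symmetric_matrix_has_eigenvector:
  fixes M :: "real^'n^'n"
  assumes sym: "transpose M = M"
  shows "\<exists>c v. v \<noteq> 0 \<and> M *v v = c *\<^sub>R v"
proof -
  have "continuous_on (sphere 0 1) (\<lambda>v. v \<bullet> (M *v v))"
    by (intro continuous_intros)
  moreover have "sphere (0::real^'n) 1 \<noteq> {}" by simp
  ultimately have "\<exists>v\<in>sphere 0 1. \<forall>w\<in>sphere 0 1. v \<bullet> (M *v v) \<le> w \<bullet> (M *v w)"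
    by (intro continuous_attains_inf compact_sphere)
  then obtain v where v: "norm v = 1"
    and least: "\<And>w. norm w = 1 \<Longrightarrow> v \<bullet> (M *v v) \<le> w \<bullet> (M *v w)"
    by auto
  define c where "c = v \<bullet> (M *v v)"
  define Q where "Q = (\<lambda>w. w \<bullet> (M *v w) - c * (w \<bullet> w))"
  have Q_nonneg: "Q w \<ge> 0" for w
  proof (cases "w = 0")
    case False
    \<comment> \<open>Minimality is known on unit vectors only; homogeneity of degree two carries it
      to every nonzero \<open>w\<close>.\<close>
    have "c \<le> sgn w \<bullet> (M *v sgn w)"
      using least[of "sgn w"] False by (simp add: c_def norm_sgn)
    also have "\<dots> = (w \<bullet> (M *v w)) / (w \<bullet> w)"
      by (simp add: sgn_div_norm matrix_vector_mult_scaleR dot_square_norm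
          power2_eq_square field_simps)
    finally show ?thesis
      using False by (simp add: Q_def field_simps)
  qed (simp add: Q_def)
  define z where "z = M *v v - c *\<^sub>R v"
  have vv: "v \<bullet> v = 1"
    using v by (simp add: dot_square_norm)
  \<comment> \<open>The constant term drops out because \<open>Q v = 0\<close>, and symmetry makes
    both mixed terms equal, so that the linear coefficient is twice the residual paired with
    \<open>z\<close>.\<close>
  have Q_line: "Q (v + t *\<^sub>R z) = 2 * t * (z \<bullet> z) + t\<^sup>2 * Q z" for t
  proof -
    have sym_vz: "v \<bullet> (M *v z) = (M *v v) \<bullet> z" "z \<bullet> (M *v v) = (M *v v) \<bullet> z"
      using symmetric_matrix_inner[OF sym] by (simp_all add: inner_commute)
    have "(v + t *\<^sub>R z) \<bullet> (M *v (v + t *\<^sub>R z))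
        = c + 2 * t * ((M *v v) \<bullet> z) + t\<^sup>2 * (z \<bullet> (M *v z))"
      unfolding matrix_vector_right_distrib matrix_vector_mult_scaleR inner_add_left
        inner_add_right inner_scaleR_left inner_scaleR_right sym_vz c_def
      by (simp only: power2_eq_square) algebra
    moreover have "(v + t *\<^sub>R z) \<bullet> (v + t *\<^sub>R z) = 1 + 2 * t * (v \<bullet> z) + t\<^sup>2 * (z \<bullet> z)"
      unfolding inner_add_left inner_add_right inner_scaleR_left inner_scaleR_right
        vv inner_commute[of z v]
      by (simp only: power2_eq_square) algebra
    moreover have "z \<bullet> z = (M *v v) \<bullet> z - c * (v \<bullet> z)"
      by (subst z_def) (simp add: inner_diff_left)
    ultimately show ?thesis
      unfolding Q_def by algebra
  qed
  \<comment> \<open>\<open>Q \<ge> 0\<close> vanishes at \<open>v\<close>, so its derivative \<open>2 * (z \<bullet> z)\<close> along \<open>z\<close> is zero; the step \<open>t\<close> below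
    is a negative one small enough to see this.\<close>
  have "z \<bullet> z = 0"
  proof (rule ccontr)
    assume nz: "z \<bullet> z \<noteq> 0"
    then have pos: "z \<bullet> z > 0" by (simp add: inner_gt_zero_iff)
    define t where "t = - (z \<bullet> z) / (Q z + 1)"
    have q: "Q z \<ge> 0" by (rule Q_nonneg)
    have "0 \<le> 2 * t * (z \<bullet> z) + t\<^sup>2 * Q z"
      using Q_nonneg Q_line by metis
    also have "\<dots> \<le> 2 * t * (z \<bullet> z) + t\<^sup>2 * (Q z + 1)"
      by (intro add_left_mono mult_left_mono) auto
    \<comment> \<open>By the choice of \<open>t\<close>, the enlarged quadratic term cancels exactly
      half of the linear one. The added 1 keeps the denominator of \<open>t\<close> positive even if
      \<open>Q z = 0\<close>.\<close>
    also have "t\<^sup>2 * (Q z + 1) = - t * (z \<bullet> z)"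
    proof -
      have "t * (Q z + 1) = - (z \<bullet> z)"
        using q by (simp add: t_def)
      then show ?thesis by (simp add: power2_eq_square mult.assoc)
    qed
    finally have "0 \<le> t * (z \<bullet> z)" by simp
    moreover have "t < 0"
      using q pos by (simp add: t_def divide_neg_pos)
    ultimately show False
      using pos by (simp add: zero_le_mult_iff)
  qed
  then have "M *v v = c *\<^sub>R v" by (simp add: z_def)
  moreover have "v \<noteq> 0" using v by auto
  ultimately show ?thesis by blast
qed

text \<open>One eigenvector \<open>e c\<close> chosen per eigenvalue gives a family of nonzero,
  pairwise orthogonal vectors; it is linearly independent, hence finite, and \<open>e\<close> is
  injective.\<close>

lemma finite_eigenvalues_symmetric_matrix:
  fixes M :: "real^'n^'n"
  assumes sym: "transpose M = M"
  shows "finite {c. \<exists>v. v \<noteq> 0 \<and> M *v v = c *\<^sub>R v}" (is "finite ?E")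
proof -
  define e where "e = (\<lambda>c. SOME v. v \<noteq> 0 \<and> M *v v = c *\<^sub>R v)"
  have e: "e c \<noteq> 0 \<and> M *v e c = c *\<^sub>R e c" if "c \<in> ?E" for c
    using someI_ex[of "\<lambda>v. v \<noteq> 0 \<and> M *v v = c *\<^sub>R v"] that by (simp add: e_def)
  have orth: "e c \<bullet> e d = 0" if "c \<in> ?E" "d \<in> ?E" "c \<noteq> d" for c d
  proof -
    \<comment> \<open>Both sides are the pairing of \<open>e c\<close> with \<open>M *v e d\<close>,
      with \<open>M\<close> acting on either factor.\<close>
    have "d * (e c \<bullet> e d) = c * (e c \<bullet> e d)"
      using symmetric_matrix_inner[OF sym, of "e c" "e d"] e[OF that(1)] e[OF that(2)] by simp
    then show ?thesis using that(3) by simp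
  qed
  have inj: "inj_on e ?E"
  proof (rule inj_onI, rule ccontr)
    fix c d assume "c \<in> ?E" "d \<in> ?E" "e c = e d" "c \<noteq> d"
    \<comment> \<open>A vector shared by two eigenvalues would be orthogonal to itself, hence
      zero.\<close>
    then show False using orth[of c d] e[of c] by simp
  qed
  have "pairwise orthogonal (e ` ?E)"
    unfolding orthogonal_def by (rule pairwise_imageI) (rule orth)
  moreover have "0 \<notin> e ` ?E"
  proof
    assume "0 \<in> e ` ?E"
    then obtain c where "c \<in> ?E" "e c = 0" by force
    then show False using e[of c] by simp
  qed
  ultimately have "finite (e ` ?E)"
    using pairwise_orthogonal_independent independent_imp_finite by blast
  then show ?thesis using inj by (rule finite_imageD)
qed

text \<open>The minimum is attained, so positive definiteness can be tested on an eigenvector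
  belonging to it.\<close>

lemma lambda_min_pos:
  assumes "sym_pos_def M"
  shows "lambda_min M > 0"
proof -
  let ?E = "{c. \<exists>v. v \<noteq> 0 \<and> M *v v = c *\<^sub>R v}"
  have sym: "transpose M = M" and pos: "\<And>v. v \<noteq> 0 \<Longrightarrow> v \<bullet> (M *v v) > 0"
    using assms by (auto simp: sym_pos_def_def)
  have "lambda_min M \<in> ?E"
    unfolding lambda_min_def
    using finite_eigenvalues_symmetric_matrix[OF sym] symmetric_matrix_has_eigenvector[OF sym]
    by (intro Min_in) auto
  then obtain v where v: "v \<noteq> 0" "M *v v = lambda_min M *\<^sub>R v" by blast
  then have "lambda_min M * (v \<bullet> v) > 0"
    using pos[of v] by simp
  then show ?thesis
    using v(1) zero_less_mult_pos2 inner_gt_zero_iff by blast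
qed

lemma norm_mult_le_op_norm: "norm (A *v v) \<le> op_norm A * norm v"
  unfolding op_norm_def by (rule onorm[OF matrix_vector_mul_bounded_linear])

lemma op_norm_zero [simp]: "op_norm 0 = 0"
  by (simp add: op_norm_def onorm_zero)

lemma op_norm_pos:
  assumes "A \<noteq> 0"
  shows "op_norm A > 0"
proof -
  have "\<not> (\<forall>v. A *v v = 0)"
    using assms by (metis matrix_eq matrix_vector_mult_0)
  then show ?thesis
    unfolding op_norm_def by (simp add: onorm_pos_lt matrix_vector_mul_bounded_linear)
qed

text \<open>The points \<open>x\<close> and \<open>x'\<close> are arbitrary, so the one bound on the
  initial step serves every iteration.\<close>

lemma next_step_unchanged:
  assumes "\<beta> > 0" "\<mu> \<ge> 0" "lambda_min S \<ge> 0"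
    and bound: "ereal t \<le> initial_step_bound A S \<beta> \<mu>"
  shows "next_step A S \<beta> \<mu> t x x' = t"
proof (cases "A *v x' = A *v x")
  case False
  define L where "L = norm (A *v x' - A *v x) / norm (x' - x)"
  \<comment> \<open>Either equality would make the two images agree. Hence the bound is finite and
    \<open>L\<close> is a genuine quotient rather than a division by zero.\<close>
  have ne: "A \<noteq> 0" "x' \<noteq> x" using False by auto
  have "L > 0" using False ne by (simp add: L_def)
  have "L \<le> op_norm A"
    using norm_mult_le_op_norm[of A "x' - x"] ne
    by (simp add: L_def matrix_vector_mult_diff_distrib field_simps)
  have "t \<le> \<mu> * sqrt (lambda_min S) / (sqrt \<beta> * op_norm A)"
    using bound ne by (simp add: initial_step_bound_def)
  also have "\<dots> \<le> \<mu> * sqrt (lambda_min S) / (sqrt \<beta> * L)"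
    using assms \<open>L > 0\<close> \<open>L \<le> op_norm A\<close>
    by (intro divide_left_mono mult_left_mono mult_pos_pos) auto
  finally show ?thesis
    using False by (simp add: next_step_def L_def)
qed (simp add: next_step_def)

text \<open>Clear the denominator and square; if \<open>A = 0\<close>, the bound is infinite but the
  left side is zero.\<close>

lemma step_bound_squared:
  assumes "\<beta> > 0" "t \<ge> 0" "lambda_min S \<ge> 0"
    and bound: "ereal t \<le> initial_step_bound A S \<beta> \<mu>"
  shows "\<beta> * t\<^sup>2 * (op_norm A)\<^sup>2 \<le> \<mu>\<^sup>2 * lambda_min S"
proof (cases "A = 0")
  case False
  then have op: "op_norm A > 0" by (rule op_norm_pos)
  have "t \<le> \<mu> * sqrt (lambda_min S) / (sqrt \<beta> * op_norm A)"
    using bound False by (simp add: initial_step_bound_def)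
  then have "t * (sqrt \<beta> * op_norm A) \<le> \<mu> * sqrt (lambda_min S)"
    using op assms by (simp add: pos_le_divide_eq)
  then have "(t * (sqrt \<beta> * op_norm A))\<^sup>2 \<le> (\<mu> * sqrt (lambda_min S))\<^sup>2"
    using op assms by (intro power_mono) auto
  then show ?thesis
    using assms by (simp add: power_mult_distrib mult_ac)
qed (use assms in simp)

lemma golden_ratio_less_2: "golden_ratio < 2"
proof -
  have "sqrt 5 < 3" by (rule real_less_lsqrt) auto
  then show ?thesis by (simp add: golden_ratio_def)
qed

theorem mainTheorem6:
  fixes g :: "real^'q \<Rightarrow> ereal" and f :: "real^'p \<Rightarrow> ereal"
    and A :: "real^'q^'m" and B :: "real^'p^'m" and b :: "real^'m"
    and S :: "real^'q^'q" and T :: "real^'p^'p"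
    and \<beta> \<psi> \<mu> :: real
    and u x :: "nat \<Rightarrow> real^'q" and w :: "nat \<Rightarrow> real^'p" and y :: "nat \<Rightarrow> real^'m"
    and \<tau> \<sigma> :: "nat \<Rightarrow> real"
  assumes g: "proper_fun g" "closed_fun g" "convex_fun g"
    and f: "proper_fun f" "closed_fun f" "convex_fun f"
    and solvable: "solutions g f A B b \<noteq> {}"
    and qualification: "\<exists>x'\<in>rel_interior (dom_fun g). \<exists>w'\<in>rel_interior (dom_fun f).
                          A *v x' + B *v w' = b"
    and S: "sym_pos_def S" and T: "sym_pos_def T"
    and tau0: "\<tau> 0 > 0" and beta: "\<beta> > 0"
    and psi: "1 < \<psi>" "\<psi> \<le> golden_ratio"
    and mu: "0 < \<mu>" "\<mu> < \<psi> / 2"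
    and iterates: "adaptive_grp_admm g f A B b S T \<beta> \<psi> \<mu> u x w y \<tau>"
    and sigma: "\<And>k. \<sigma> k = \<beta> * \<tau> k"
    and bound: "ereal (\<tau> 0) \<le> initial_step_bound A S \<beta> \<mu>"
  shows "(\<forall>k\<ge>1. \<tau> k = \<tau> 0) \<and>
         (\<forall>k\<ge>1. \<sigma> k = \<beta> * \<tau> 0) \<and>
         (\<forall>k\<ge>1. \<tau> k * \<sigma> k * (op_norm A)\<^sup>2 = \<beta> * (\<tau> 0)\<^sup>2 * (op_norm A)\<^sup>2 \<and>
                \<beta> * (\<tau> 0)\<^sup>2 * (op_norm A)\<^sup>2 \<le> \<mu>\<^sup>2 * lambda_min S \<and>
                \<mu>\<^sup>2 * lambda_min S < \<psi> * lambda_min S) \<and>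
         fixed_step_condition A S \<psi> (\<tau> 0) (\<beta> * \<tau> 0)"
proof -
  have lam: "lambda_min S > 0" using S by (rule lambda_min_pos)
  have tau: "\<tau> k = \<tau> 0" for k
  proof (induction k)
    case (Suc k)
    have "\<tau> (Suc k) = next_step A S \<beta> \<mu> (\<tau> k) (x k) (x (Suc k))"
      using iterates by (simp add: adaptive_grp_admm_def)
    also have "\<dots> = \<tau> 0"
      \<comment> \<open>The induction hypothesis replaces \<open>\<tau> k\<close> by
        \<open>\<tau> 0\<close>, the value to which \<open>bound\<close> applies.\<close>
      using Suc next_step_unchanged[OF beta _ _ bound] mu lam by simp
    finally show ?case .
  qed simp
  have le: "\<beta> * (\<tau> 0)\<^sup>2 * (op_norm A)\<^sup>2 \<le> \<mu>\<^sup>2 * lambda_min S"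
    using step_bound_squared[OF beta _ _ bound] tau0 lam by simp
  \<comment> \<open>Half the golden ratio is below 1, so squaring \<open>\<mu>\<close> does not
    increase it and \<open>\<mu>\<close> is already below \<open>\<psi>\<close>.\<close>
  have "\<mu> < 1" using mu psi golden_ratio_less_2 by simp
  then have "\<mu>\<^sup>2 \<le> \<mu>"
    using mu by (simp add: power2_eq_square mult_le_cancel_left1)
  then have "\<mu>\<^sup>2 < \<psi>" using mu psi by linarith
  then have less: "\<mu>\<^sup>2 * lambda_min S < \<psi> * lambda_min S"
    using lam by simp
  have eq: "\<tau> 0 * (\<beta> * \<tau> 0) * (op_norm A)\<^sup>2 = \<beta> * (\<tau> 0)\<^sup>2 * (op_norm A)\<^sup>2"
    by (simp add: power2_eq_square)
  have "fixed_step_condition A S \<psi> (\<tau> 0) (\<beta> * \<tau> 0)"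
    unfolding fixed_step_condition_def eq using le less by linarith
  moreover have "\<tau> k * \<sigma> k * (op_norm A)\<^sup>2 = \<beta> * (\<tau> 0)\<^sup>2 * (op_norm A)\<^sup>2" for k
    unfolding sigma tau[of k] by (rule eq)
  ultimately show ?thesis
    using tau sigma le less by metis
qed

end
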